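(* Let $\mathcal A$ be a nondeterministic $\mathrm{Inf}$ (or $\mathrm{Safety}$) automaton on infinite words. Then Eve wins the one-token game $G_1(\mathcal A)$ if and only if $\mathcal A$ is history-deterministic, and winning strategies for Eve in $G_1(\mathcal A)$ induce winning strategies for Eve in the letter game on $\mathcal A$ of the same memory size.
   Context: **Automata.** A (nondeterministic quantitative) automaton is a tuple $\mathcal A=(\Sigma,Q,\iota,\delta)$ with $\Sigma$ a finite nonempty alphabet, $Q$ a finite nonempty set of states, $\iota\in Q$ the initial state, and $\delta:Q\times\Sigma\to 2^{\mathbb Q\times Q}$ a transition function whose values are finite and nonempty (the automaton is total). If $(x,q')\in\delta(q,\sigma)$ we write $q\xrightarrow{\sigma:x}q'$ for this transition, of weight $x$. A run on an infinite word $w=\sigma_0\sigma_1\ldots$ is a sequence of transitions $q_0\xrightarrow{\sigma_0:x_0}q_1\xrightarrow{\sigma_1:x_1}\ldots$ with $q_0=\iota$. An $\mathrm{Inf}$ automaton is equipped with the value function $\mathrm{Val}=\mathrm{Inf}$, $\mathrm{Inf}(v_0v_1\ldots)=\inf\{v_n\mid n\ge0\}$. A $\mathrm{Safety}$ automaton is an $\mathrm{Inf}$ automaton with weights in $\{0,1\}$ in which every transition of weight $0$ (rejecting transition) leads to a sink all of whose outgoing transitions are self-loops of weight $0$; a word is accepted if its value is $1$. The value $\mathrm{Val}(\rho)$ of a run $\rho$ is the value function applied to its weight sequence, and $\mathcal A(w)$ is the supremum of the values of all runs of $\mathcal A$ on $w$. **Letter game and history-determinism.** A play of the letter game on $\mathcal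 A$ starts in $q_0=\iota$; in turn $i=0,1,\ldots$, from state $q_i$, Adam picks a letter $\sigma_i\in\Sigma$ and then Eve picks a transition $t_i=q_i\xrightarrow{\sigma_i:x_i}q_{i+1}$. This yields an infinite word $w=\sigma_0\sigma_1\ldots$ and an infinite sequence $\pi=t_0t_1\ldots$. Eve wins if $\mathrm{Val}(\pi)\ge\mathcal A(w)$. $\mathcal A$ is history-deterministic (HD) if Eve has a winning strategy in the letter game. **Token game $G_1(\mathcal A)$.** Configurations are pairs $(q,p)\in Q^2$, initially $(\iota,\iota)$. In turn $i$, from $(q_i,p_i)$: Adam picks a letter $\sigma_i\in\Sigma$; then Eve picks a transition $q_i\xrightarrow{\sigma_i:x_i}q_{i+1}$; then Adam picks a transition $p_i\xrightarrow{\sigma_i:y_i}p_{i+1}$. This yields two infinite runs, $\pi$ (Eve) and $\pi_1$ (Adam). Eve wins if $\mathrm{Val}(\pi)\ge\mathrm{Val}(\pi_1)$. A player wins a game if they have a winning strategy in it. **Memory.** A strategy of Eve has memory of size $m$ if it is implemented by a set $M$ of $m$ memory states with an initial one, an update function that updates the memory state after each move as a function of the current memory state and the move made (including the current position), and a next-move function that chooses Eve's transition as a function of the current memory state and the current game position (in the letter game: Eve's current state and the letter just played; in $G_1$: the states of both tokens and the letter just played). *)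

theory Defs
  imports Complex_Main "HOL-Library.Equipollence"
begin

section \<open>Quantitative automata\<close>

text \<open>A transition from \<open>q\<close> over \<open>a\<close> with weight \<open>x\<close> to \<open>q'\<close> is rendered as \<open>(x, q') \<in> delta A q a\<close>.\<close>

record ('a, 'q) automaton =
  alphabet :: "'a set"
  states :: "'q set"
  initial :: 'q
  delta :: "'q \<Rightarrow> 'a \<Rightarrow> (rat \<times> 'q) set"
  val :: "(nat \<Rightarrow> rat) \<Rightarrow> real"

definition automaton :: "('a, 'q) automaton \<Rightarrow> bool" where
  "automaton A \<longleftrightarrow>
     finite (alphabet A) \<and> alphabet A \<noteq> {} \<and>
     finite (states A) \<and> initial A \<in> states A \<and>
     (\<forall>q \<in> states A. \<forall>a \<in> alphabet A.
        finite (delta A q a) \<and> delta A q a \<noteq> {} \<and> delta A q a \<subseteq> UNIV \<times> states A)"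

text \<open>An automaton has only finitely many weights, so on weight sequences of runs the infimum below,
  and the supremum in \<open>aut_value\<close>, range over bounded nonempty sets of reals.\<close>

definition Inf_val :: "(nat \<Rightarrow> rat) \<Rightarrow> real" where
  "Inf_val x = (INF n. real_of_rat (x n))"

definition Inf_automaton :: "('a, 'q) automaton \<Rightarrow> bool" where
  "Inf_automaton A \<longleftrightarrow> automaton A \<and> val A = Inf_val"

definition Safety_automaton :: "('a, 'q) automaton \<Rightarrow> bool" where
  "Safety_automaton A \<longleftrightarrow> Inf_automaton A \<and>
     (\<forall>q \<in> states A. \<forall>a \<in> alphabet A. \<forall>(x, q') \<in> delta A q a.
        x \<in> {0, 1} \<and>
        (x = 0 \<longrightarrow> (\<forall>b \<in> alphabet A. delta A q' b = {(0, q')})))"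

text \<open>A run is given by its state sequence \<open>q\<close> and its weight sequence \<open>x\<close>.\<close>

definition is_run :: "('a, 'q) automaton \<Rightarrow> (nat \<Rightarrow> 'a) \<Rightarrow> (nat \<Rightarrow> 'q) \<Rightarrow> (nat \<Rightarrow> rat) \<Rightarrow> bool" where
  "is_run A w q x \<longleftrightarrow> q 0 = initial A \<and> (\<forall>i. (x i, q (Suc i)) \<in> delta A (q i) (w i))"

definition aut_value :: "('a, 'q) automaton \<Rightarrow> (nat \<Rightarrow> 'a) \<Rightarrow> real" where
  "aut_value A w = Sup {val A x | q x. is_run A w q x}"

section \<open>Games, strategies and memory\<close>

text \<open>\<open>eve\<close> is the set of Eve's positions (all others are Adam's) and \<open>eve_wins\<close> the set of infinite
  move sequences won by Eve. Since the start position is fixed and \<open>step\<close> is a function, a sequence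
  of moves determines the positions it visits; a strategy for Eve therefore maps finite
  histories of moves to moves, and only its values on legal histories ending in a position of Eve
  matter.\<close>

record ('v, 'b) game =
  start :: 'v
  eve :: "'v set"
  legal :: "'v \<Rightarrow> 'b set"
  step :: "'v \<Rightarrow> 'b \<Rightarrow> 'v"
  eve_wins :: "(nat \<Rightarrow> 'b) set"

definition position :: "('v, 'b) game \<Rightarrow> 'b list \<Rightarrow> 'v" where
  "position G h = foldl (step G) (start G) h"

definition legal_history :: "('v, 'b) game \<Rightarrow> 'b list \<Rightarrow> bool" where
  "legal_history G h \<longleftrightarrow> (\<forall>n < length h. h ! n \<in> legal G (position G (take n h)))"

definition prefix_of :: "(nat \<Rightarrow> 'b) \<Rightarrow> nat \<Rightarrow> 'b list" where
  "prefix_of P n = map P [0..<n]"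

definition legal_play :: "('v, 'b) game \<Rightarrow> (nat \<Rightarrow> 'b) \<Rightarrow> bool" where
  "legal_play G P \<longleftrightarrow> (\<forall>n. P n \<in> legal G (position G (prefix_of P n)))"

definition eve_strategy :: "('v, 'b) game \<Rightarrow> ('b list \<Rightarrow> 'b) \<Rightarrow> bool" where
  "eve_strategy G s \<longleftrightarrow>
     (\<forall>h. legal_history G h \<longrightarrow> position G h \<in> eve G \<longrightarrow> s h \<in> legal G (position G h))"

definition consistent :: "('v, 'b) game \<Rightarrow> ('b list \<Rightarrow> 'b) \<Rightarrow> (nat \<Rightarrow> 'b) \<Rightarrow> bool" where
  "consistent G s P \<longleftrightarrow>
     (\<forall>n. position G (prefix_of P n) \<in> eve G \<longrightarrow> P n = s (prefix_of P n))"

definition winning_strategy :: "('v, 'b) game \<Rightarrow> ('b list \<Rightarrow> 'b) \<Rightarrow> bool" where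
  "winning_strategy G s \<longleftrightarrow> eve_strategy G s \<and>
     (\<forall>P. legal_play G P \<longrightarrow> consistent G s P \<longrightarrow> P \<in> eve_wins G)"

definition Eve_wins :: "('v, 'b) game \<Rightarrow> bool" where
  "Eve_wins G \<longleftrightarrow> (\<exists>s. winning_strategy G s)"

text \<open>The memory is updated after every move of either player, depending on the position in which
  the move is made.\<close>

primrec memory_from ::
  "('v, 'b) game \<Rightarrow> ('m \<Rightarrow> 'v \<Rightarrow> 'b \<Rightarrow> 'm) \<Rightarrow> 'v \<Rightarrow> 'm \<Rightarrow> 'b list \<Rightarrow> 'm" where
  "memory_from G upd v m [] = m"
| "memory_from G upd v m (b # h) = memory_from G upd (step G v b) (upd m v b) h"

text \<open>\<open>implemented_with G s M\<close>: the strategy \<open>s\<close> has an implementation whose set of memory states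
  is \<open>M\<close>, that is, \<open>s\<close> has memory of size \<open>card M\<close> if \<open>M\<close> is finite; \<open>M\<close> may also be infinite.\<close>

definition implemented_with :: "('v, 'b) game \<Rightarrow> ('b list \<Rightarrow> 'b) \<Rightarrow> 'm set \<Rightarrow> bool" where
  "implemented_with G s M \<longleftrightarrow>
     (\<exists>m0 upd nxt. m0 \<in> M \<and> (\<forall>m \<in> M. \<forall>v b. upd m v b \<in> M) \<and>
        (\<forall>h. legal_history G h \<longrightarrow> position G h \<in> eve G \<longrightarrow>
           s h = nxt (memory_from G upd (start G) m0 h) (position G h)))"

section \<open>The letter game and the one-token game\<close>

datatype ('a, 'q) move = Letter (letter: 'a) | Transition (weight: rat) (target: 'q)

definition transitions :: "('a, 'q) automaton \<Rightarrow> 'q \<Rightarrow> 'a \<Rightarrow> ('a, 'q) move set" where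
  "transitions A q a = {Transition x q' | x q'. (x, q') \<in> delta A q a}"

datatype ('a, 'q) letter_pos = LAdam 'q | LEve 'q 'a

fun letter_legal :: "('a, 'q) automaton \<Rightarrow> ('a, 'q) letter_pos \<Rightarrow> ('a, 'q) move set" where
  "letter_legal A (LAdam q) = Letter ` alphabet A"
| "letter_legal A (LEve q a) = transitions A q a"

fun letter_step :: "('a, 'q) letter_pos \<Rightarrow> ('a, 'q) move \<Rightarrow> ('a, 'q) letter_pos" where
  "letter_step (LAdam q) b = LEve q (letter b)"
| "letter_step (LEve q a) b = LAdam (target b)"

definition letter_game :: "('a, 'q) automaton \<Rightarrow> (('a, 'q) letter_pos, ('a, 'q) move) game" where
  "letter_game A =
     \<lparr> start = LAdam (initial A),
       eve = {LEve q a | q a. True},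
       legal = letter_legal A,
       step = letter_step,
       eve_wins = {P. val A (\<lambda>i. weight (P (2 * i + 1))) \<ge> aut_value A (\<lambda>i. letter (P (2 * i)))} \<rparr>"

definition history_deterministic :: "('a, 'q) automaton \<Rightarrow> bool" where
  "history_deterministic A \<longleftrightarrow> Eve_wins (letter_game A)"

text \<open>The first state of a token position is that of Eve's token, the second that of Adam's. In
  \<open>TTrans\<close>, Eve has already moved her token over the current letter and Adam has yet to move his.\<close>

datatype ('a, 'q) token_pos = TLetter 'q 'q | TEve 'q 'q 'a | TTrans 'q 'q 'a

fun token_legal :: "('a, 'q) automaton \<Rightarrow> ('a, 'q) token_pos \<Rightarrow> ('a, 'q) move set" where
  "token_legal A (TLetter q p) = Letter ` alphabet A"
| "token_legal A (TEve q p a) = transitions A q a"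
| "token_legal A (TTrans q p a) = transitions A p a"

fun token_step :: "('a, 'q) token_pos \<Rightarrow> ('a, 'q) move \<Rightarrow> ('a, 'q) token_pos" where
  "token_step (TLetter q p) b = TEve q p (letter b)"
| "token_step (TEve q p a) b = TTrans (target b) p a"
| "token_step (TTrans q p a) b = TLetter q (target b)"

definition G1 :: "('a, 'q) automaton \<Rightarrow> (('a, 'q) token_pos, ('a, 'q) move) game" where
  "G1 A =
     \<lparr> start = TLetter (initial A) (initial A),
       eve = {TEve q p a | q p a. True},
       legal = token_legal A,
       step = token_step,
       eve_wins = {P. val A (\<lambda>i. weight (P (3 * i + 1))) \<ge> val A (\<lambda>i. weight (P (3 * i + 2)))} \<rparr>"

end

theory Submission imports Defs begin

text \<open>From a winning strategy for \<open>G1 A\<close>, Eve obtains one for the letter game by imagining that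
  Adam copies each of her transitions, so that both tokens always share a state and no additional
  memory is needed. It wins for the following reason. Let \<open>v\<close> be the value of some run on the word
  played. Inductively, Eve has seen only weights at least \<open>v\<close> and her current state still admits a
  continuation with weights at least \<open>v\<close>: if Adam has copied her so far and now switches to this
  continuation, his run has value at least \<open>v\<close>, hence so does Eve's response, whose next transition
  is the one she makes in the letter game. Conversely, a winning strategy for the letter game wins
  \<open>G1 A\<close> when Adam's transitions are ignored.\<close>

section \<open>Histories and plays\<close>

lemma position_Nil [simp]: "position G [] = start G"
  by (simp add: position_def)

lemma position_append [simp]: "position G (h @ h') = foldl (step G) (position G h) h'"
  by (simp add: position_def)

lemma legal_history_Nil [simp]: "legal_history G []"
  by (simp add: legal_history_def)

lemma legal_history_snoc [simp]:
  "legal_history G (h @ [b]) \<longleftrightarrow> legal_history G h \<and> b \<in> legal G (position G h)"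
  by (auto simp: legal_history_def nth_append less_Suc_eq all_conj_distrib)

lemma memory_from_append [simp]:
  "memory_from G upd v m (h @ h') =
     memory_from G upd (foldl (step G) v h) (memory_from G upd v m h) h'"
  by (induction h arbitrary: v m) auto

lemma prefix_of_0 [simp]: "prefix_of P 0 = []"
  by (simp add: prefix_of_def)

lemma prefix_of_Suc [simp]: "prefix_of P (Suc n) = prefix_of P n @ [P n]"
  by (simp add: prefix_of_def)

lemma prefix_of_add2: "prefix_of P (n + 2) = prefix_of P n @ [P n, P (n + 1)]"
  and prefix_of_add3: "prefix_of P (n + 3) = prefix_of P n @ [P n, P (n + 1), P (n + 2)]"
  by (simp_all add: numeral_3_eq_3)

lemma length_prefix_of [simp]: "length (prefix_of P n) = n"
  by (simp add: prefix_of_def)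

text \<open>Adam's choices may be fixed in advance as a function \<open>c\<close> of the move number
  alone, which suffices for an Adam who follows a given word and run. Legality is a separate matter,
  since \<open>c\<close> and \<open>s\<close> are arbitrary here.\<close>

lemma consistent_play_exists:
  "\<exists>P. consistent G s P \<and> (\<forall>n. position G (prefix_of P n) \<notin> eve G \<longrightarrow> P n = c n)"
proof -
  define move where "move h = (if position G h \<in> eve G then s h else c (length h))" for h
  define hist where "hist = rec_nat [] (\<lambda>_ h. h @ [move h])"
  define P where "P n = move (hist n)" for n
  have "prefix_of P n = hist n" for n
    by (induction n) (simp_all add: hist_def P_def)
  then have "P n = move (prefix_of P n)" for n
    by (simp add: P_def)
  then show ?thesis
    by (intro exI[of _ P]) (simp add: consistent_def move_def)
qed

section \<open>Positions and runs in the two games\<close>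

lemma letter_game_simps [simp]:
  "start (letter_game A) = LAdam (initial A)"
  "eve (letter_game A) = {LEve q a | q a. True}"
  "legal (letter_game A) = letter_legal A"
  "step (letter_game A) = letter_step"
  "P \<in> eve_wins (letter_game A) \<longleftrightarrow>
     aut_value A (\<lambda>i. letter (P (2 * i))) \<le> val A (\<lambda>i. weight (P (2 * i + 1)))"
  by (simp_all add: letter_game_def)

lemma G1_simps [simp]:
  "start (G1 A) = TLetter (initial A) (initial A)"
  "eve (G1 A) = {TEve q p a | q p a. True}"
  "legal (G1 A) = token_legal A"
  "step (G1 A) = token_step"
  "P \<in> eve_wins (G1 A) \<longleftrightarrow>
     val A (\<lambda>i. weight (P (3 * i + 2))) \<le> val A (\<lambda>i. weight (P (3 * i + 1)))"
  by (simp_all add: G1_def)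

text \<open>A move records only where its transition ends, so the states of a token are recovered
  from its moves, shifted by one and preceded by the initial state.\<close>

definition states_along :: "('a, 'q) automaton \<Rightarrow> (nat \<Rightarrow> ('a, 'q) move) \<Rightarrow> nat \<Rightarrow> 'q" where
  "states_along A t i = (case i of 0 \<Rightarrow> initial A | Suc j \<Rightarrow> target (t j))"

lemma states_along_0 [simp]: "states_along A t 0 = initial A"
  and states_along_Suc [simp]: "states_along A t (Suc i) = target (t i)"
  by (simp_all add: states_along_def)

text \<open>The equation on the right excludes \<open>Letter\<close> moves, on which
  \<open>weight\<close> and \<open>target\<close> say nothing.\<close>

lemma in_transitions_iff:
  "b \<in> transitions A q a \<longleftrightarrow>
     b = Transition (weight b) (target b) \<and> (weight b, target b) \<in> delta A q a"
  by (cases b) (auto simp: transitions_def)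

lemma in_letters_iff: "b \<in> Letter ` S \<longleftrightarrow> b = Letter (letter b) \<and> letter b \<in> S"
  by (cases b) auto

lemma letter_position:
  fixes A :: "('a, 'q) automaton" and P :: "nat \<Rightarrow> ('a, 'q) move"
  defines "q \<equiv> states_along A (\<lambda>i. P (2 * i + 1))"
  shows "position (letter_game A) (prefix_of P (2 * i)) = LAdam (q i)"
    and "position (letter_game A) (prefix_of P (2 * i + 1)) = LEve (q i) (letter (P (2 * i)))"
proof -
  show "position (letter_game A) (prefix_of P (2 * i)) = LAdam (q i)"
    by (induction i) (simp_all add: q_def)
  then show "position (letter_game A) (prefix_of P (2 * i + 1)) = LEve (q i) (letter (P (2 * i)))"
    by simp
qed

lemma token_position:
  fixes A :: "('a, 'q) automaton" and R :: "nat \<Rightarrow> ('a, 'q) move"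
  defines "q \<equiv> states_along A (\<lambda>i. R (3 * i + 1))"
    and "p \<equiv> states_along A (\<lambda>i. R (3 * i + 2))"
  shows "position (G1 A) (prefix_of R (3 * i)) = TLetter (q i) (p i)"
    and "position (G1 A) (prefix_of R (3 * i + 1)) = TEve (q i) (p i) (letter (R (3 * i)))"
    and "position (G1 A) (prefix_of R (3 * i + 2)) = TTrans (q (Suc i)) (p i) (letter (R (3 * i)))"
proof -
  show *: "position (G1 A) (prefix_of R (3 * i)) = TLetter (q i) (p i)"
  proof (induction i)
    case (Suc i)
    have "3 * Suc i = Suc (Suc (Suc (3 * i)))"
      by simp
    with Suc show ?case
      by (simp add: q_def p_def del: mult_Suc_right)
  qed (simp add: q_def p_def)
  show "position (G1 A) (prefix_of R (3 * i + 1)) = TEve (q i) (p i) (letter (R (3 * i)))"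
    using * by simp
  then show "position (G1 A) (prefix_of R (3 * i + 2)) = TTrans (q (Suc i)) (p i) (letter (R (3 * i)))"
    by (simp add: q_def)
qed

section \<open>Plays split into rounds of two or three moves\<close>

lemma all_nat_mod2: "(\<forall>n. Q n) \<longleftrightarrow> (\<forall>i. Q (2 * i) \<and> Q (2 * i + 1))" for Q :: "nat \<Rightarrow> bool"
  by (metis evenE oddE)

lemma all_nat_mod3: "(\<forall>n. Q n) \<longleftrightarrow> (\<forall>i. Q (3 * i) \<and> Q (3 * i + 1) \<and> Q (3 * i + 2))"
  for Q :: "nat \<Rightarrow> bool"
proof (intro iffI allI)
  fix n :: nat
  assume *: "\<forall>i. Q (3 * i) \<and> Q (3 * i + 1) \<and> Q (3 * i + 2)"
  have "n = 3 * (n div 3) \<or> n = 3 * (n div 3) + 1 \<or> n = 3 * (n div 3) + 2"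
    by presburger
  with * show "Q n"
    by metis
qed simp

lemma legal_play_letter_iff:
  "legal_play (letter_game A) P \<longleftrightarrow>
     (\<forall>i. P (2 * i) \<in> Letter ` alphabet A \<and>
       P (2 * i + 1) \<in> transitions A (states_along A (\<lambda>i. P (2 * i + 1)) i) (letter (P (2 * i))))"
  unfolding legal_play_def by (subst all_nat_mod2) (simp only: letter_position letter_game_simps letter_legal.simps)

lemma consistent_letter_iff:
  "consistent (letter_game A) s P \<longleftrightarrow> (\<forall>i. P (2 * i + 1) = s (prefix_of P (2 * i + 1)))"
  unfolding consistent_def by (subst all_nat_mod2) (simp only: letter_position, auto)

lemma legal_play_G1_iff:
  "legal_play (G1 A) R \<longleftrightarrow>
     (\<forall>i. R (3 * i) \<in> Letter ` alphabet A \<and>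
       R (3 * i + 1) \<in> transitions A (states_along A (\<lambda>i. R (3 * i + 1)) i) (letter (R (3 * i))) \<and>
       R (3 * i + 2) \<in> transitions A (states_along A (\<lambda>i. R (3 * i + 2)) i) (letter (R (3 * i))))"
  unfolding legal_play_def by (subst all_nat_mod3) (simp only: token_position G1_simps token_legal.simps)

lemma consistent_G1_iff:
  "consistent (G1 A) s R \<longleftrightarrow> (\<forall>i. R (3 * i + 1) = s (prefix_of R (3 * i + 1)))"
  unfolding consistent_def by (subst all_nat_mod3) (simp only: token_position, auto)

lemma is_run_states_along:
  assumes "\<And>i. t i \<in> transitions A (states_along A t i) (w i)"
  shows "is_run A w (states_along A t) (\<lambda>i. weight (t i))"
  using assms by (simp add: is_run_def in_transitions_iff)

section \<open>Values of runs\<close>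

lemma run_weights:
  assumes "automaton A" "range w \<subseteq> alphabet A" "is_run A w q x"
  shows "x i \<in> (\<Union>q \<in> states A. \<Union>a \<in> alphabet A. fst ` delta A q a)"
proof -
  have "q i \<in> states A" for i
  proof (induction i)
    case 0
    with assms show ?case
      by (simp add: automaton_def is_run_def)
  next
    case (Suc i)
    have "(x i, q (Suc i)) \<in> delta A (q i) (w i)" "w i \<in> alphabet A"
      using assms by (auto simp: is_run_def)
    with Suc show ?case
      using assms(1) unfolding automaton_def by blast
  qed
  moreover have "(x i, q (Suc i)) \<in> delta A (q i) (w i)" "w i \<in> alphabet A"
    using assms by (auto simp: is_run_def)
  ultimately show ?thesis
    by force
qed

lemma finite_weights:
  "automaton A \<Longrightarrow> finite (\<Union>q \<in> states A. \<Union>a \<in> alphabet A. fst ` delta A q a)"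
  by (auto simp: automaton_def)

text \<open>A real infimum is meaningful only on sets bounded below; here the finiteness of the set
  of weights gives the bound. Comparisons with \<open>Inf_val\<close> can then be checked transition
  by transition.\<close>

lemma le_Inf_val_iff:
  assumes "automaton A" "range w \<subseteq> alphabet A" "is_run A w q x"
  shows "v \<le> Inf_val x \<longleftrightarrow> (\<forall>i. v \<le> real_of_rat (x i))"
proof -
  have "finite (range x)"
    using run_weights[OF assms] by (intro finite_subset[OF _ finite_weights[OF assms(1)]]) auto
  then have "bdd_below (range (\<lambda>i. real_of_rat (x i)))"
    by (metis bdd_below_finite finite_imageI image_image)
  then show ?thesis
    by (simp add: Inf_val_def le_cINF_iff)
qed

text \<open>The supremum is over a set bounded above: the infimum of a run is at most its first
  weight, hence at most the largest weight of the automaton.\<close>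

lemma run_le_aut_value:
  assumes "Inf_automaton A" "range w \<subseteq> alphabet A" "is_run A w q x"
  shows "val A x \<le> aut_value A w"
proof -
  have A: "automaton A" "val A = Inf_val"
    using assms(1) by (auto simp: Inf_automaton_def)
  define W where "W = real_of_rat ` (\<Union>q \<in> states A. \<Union>a \<in> alphabet A. fst ` delta A q a)"
  have "val A y \<le> Max W" if "is_run A w p y" for p y
  proof -
    have "val A y \<le> real_of_rat (y 0)"
      using le_Inf_val_iff[OF A(1) assms(2) that] A(2) by fastforce
    also have "\<dots> \<le> Max W"
      using run_weights[OF A(1) assms(2) that] finite_weights[OF A(1)] by (simp add: W_def)
    finally show ?thesis .
  qed
  then have "bdd_above {val A x | q x. is_run A w q x}"
    by (auto simp: bdd_above_def)
  with assms(3) show ?thesis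
    unfolding aut_value_def by (intro cSup_upper) auto
qed

section \<open>From the one-token game to the letter game\<close>

text \<open>Histories of the letter game alternate letters and transitions; this doubles the transitions.\<close>

definition adam_copies :: "'b list \<Rightarrow> 'b list" where
  "adam_copies h = concat (map (\<lambda>(i, b). if even i then [b] else [b, b]) (List.enumerate 0 h))"

lemma adam_copies_Nil [simp]: "adam_copies [] = []"
  by (simp add: adam_copies_def)

lemma adam_copies_snoc [simp]:
  "adam_copies (h @ [b]) = adam_copies h @ (if even (length h) then [b] else [b, b])"
  by (simp add: adam_copies_def enumerate_append_eq)

fun both_tokens :: "('a, 'q) letter_pos \<Rightarrow> ('a, 'q) token_pos" where
  "both_tokens (LAdam q) = TLetter q q"
| "both_tokens (LEve q a) = TEve q q a"

lemma letter_position_parity: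
  "\<exists>q a. position (letter_game A) h = (if even (length h) then LAdam q else LEve q a)"
  by (induction h rule: rev_induct) (auto split: if_splits)

lemma position_adam_copies:
  "position (G1 A) (adam_copies h) = both_tokens (position (letter_game A) h)"
proof (induction h rule: rev_induct)
  case (snoc b h)
  obtain q a where "position (letter_game A) h = (if even (length h) then LAdam q else LEve q a)"
    using letter_position_parity by metis
  with snoc show ?case
    by (simp split: if_splits)
qed simp

lemma legal_history_adam_copies:
  "legal_history (letter_game A) h \<Longrightarrow> legal_history (G1 A) (adam_copies h)"
proof (induction h rule: rev_induct)
  case (snoc b h)
  obtain q a where "position (letter_game A) h = (if even (length h) then LAdam q else LEve q a)"
    using letter_position_parity by metis
  with snoc show ?case
    \<comment> \<open>A transition is appended twice; this instance handles the second copy, which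
      is legal because Adam's token leaves the same state over the same letter.\<close>
    using legal_history_snoc[of "G1 A" "adam_copies h @ [b]" b]
    by (simp add: position_adam_copies split: if_splits)
qed simp

text \<open>One transition in the letter game stands for two moves in \<open>G1 A\<close>, Eve's and
  Adam's copy. Both updates happen at once, so the set of memory states stays the same. Before the
  copy, Adam's token is still in \<open>q\<close>.\<close>

fun letter_update ::
  "('m \<Rightarrow> ('a, 'q) token_pos \<Rightarrow> ('a, 'q) move \<Rightarrow> 'm) \<Rightarrow> 'm \<Rightarrow> ('a, 'q) letter_pos \<Rightarrow> ('a, 'q) move \<Rightarrow> 'm" where
  "letter_update upd m (LAdam q) b = upd m (TLetter q q) b"
| "letter_update upd m (LEve q a) b = upd (upd m (TEve q q a) b) (TTrans (target b) q a) b"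

lemma memory_adam_copies:
  "memory_from (G1 A) upd (start (G1 A)) m (adam_copies h) =
     memory_from (letter_game A) (letter_update upd) (start (letter_game A)) m h"
proof (induction h rule: rev_induct)
  case (snoc b h)
  obtain q a where "position (letter_game A) h = (if even (length h) then LAdam q else LEve q a)"
    using letter_position_parity by metis
  with snoc position_adam_copies[of A h] show ?case
    by (simp add: position_def split: if_splits)
qed simp

lemma implemented_with_adam_copies:
  fixes M :: "'m set"
  assumes "implemented_with (G1 A) s M"
  shows "implemented_with (letter_game A) (s \<circ> adam_copies) M"
proof -
  obtain m0 upd nxt where m0: "m0 \<in> M" and upd: "\<And>m v b. m \<in> M \<Longrightarrow> upd m v b \<in> M"
    and nxt: "\<And>h. legal_history (G1 A) h \<Longrightarrow> position (G1 A) h \<in> eve (G1 A) \<Longrightarrow>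
      s h = nxt (memory_from (G1 A) upd (start (G1 A)) m0 h) (position (G1 A) h)"
    using assms unfolding implemented_with_def by metis
  have "letter_update upd m v b \<in> M" if "m \<in> M" for m v b
    using that upd by (cases v) auto
  moreover have "(s \<circ> adam_copies) h =
      (nxt (memory_from (letter_game A) (letter_update upd) (start (letter_game A)) m0 h) \<circ> both_tokens)
        (position (letter_game A) h)"
    if "legal_history (letter_game A) h" "position (letter_game A) h \<in> eve (letter_game A)" for h
    using nxt[OF legal_history_adam_copies[OF that(1)]] that(2)
    unfolding memory_adam_copies position_adam_copies by auto
  ultimately show ?thesis
    unfolding implemented_with_def using m0
    by (intro exI[of _ m0] exI[of _ "letter_update upd"]
        exI[of _ "\<lambda>m. nxt m \<circ> both_tokens"]) auto
qed

lemma eve_strategy_adam_copies: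
  assumes "eve_strategy (G1 A) s"
  shows "eve_strategy (letter_game A) (s \<circ> adam_copies)"
  unfolding eve_strategy_def
proof (intro allI impI)
  fix h
  assume h: "legal_history (letter_game A) h" "position (letter_game A) h \<in> eve (letter_game A)"
  then obtain q a where "position (letter_game A) h = LEve q a"
    by auto
  then show "(s \<circ> adam_copies) h \<in> legal (letter_game A) (position (letter_game A) h)"
    using assms legal_history_adam_copies[OF h(1)] position_adam_copies[of A h]
    unfolding eve_strategy_def by fastforce
qed

section \<open>Plays of \<open>G1 A\<close> against a prescribed run of Adam\<close>

lemma legal_history_prefix_of:
  "(\<And>i. i < n \<Longrightarrow> P i \<in> legal G (position G (prefix_of P i))) \<Longrightarrow> legal_history G (prefix_of P n)"
  by (induction n) auto

text \<open>A strategy promises legal moves only after legal histories, so the legality of each move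
  of Eve rests on that of all earlier moves; hence the strong induction.\<close>

lemma legal_consistent_play:
  assumes "eve_strategy G s" "consistent G s P"
    and "\<And>n. position G (prefix_of P n) \<notin> eve G \<Longrightarrow> P n \<in> legal G (position G (prefix_of P n))"
  shows "legal_play G P"
  unfolding legal_play_def
proof
  fix n
  show "P n \<in> legal G (position G (prefix_of P n))"
  proof (induction n rule: less_induct)
    case (less n)
    then have "legal_history G (prefix_of P n)"
      by (rule legal_history_prefix_of)
    with assms show ?case
      unfolding eve_strategy_def consistent_def by metis
  qed
qed

lemma G1_response:
  assumes "eve_strategy (G1 A) s" "range w \<subseteq> alphabet A" "is_run A w p y"
  shows "\<exists>R. legal_play (G1 A) R \<and> consistent (G1 A) s R \<and>
    (\<forall>i. R (3 * i) = Letter (w i) \<and> R (3 * i + 2) = Transition (y i) (p (Suc i)))"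
proof -
  \<comment> \<open>The value of \<open>c\<close> at numbers congruent to 1 modulo 3 is never
    consulted: these are Eve's turns.\<close>
  define c where "c n = (if n mod 3 = 0 then Letter (w (n div 3))
    else Transition (y (n div 3)) (p (Suc (n div 3))))" for n
  obtain R where R: "consistent (G1 A) s R"
    and adam: "\<And>n. position (G1 A) (prefix_of R n) \<notin> eve (G1 A) \<Longrightarrow> R n = c n"
    using consistent_play_exists by metis
  have letters: "R (3 * i) = Letter (w i)" for i
    using adam[of "3 * i"] by (simp only: token_position) (simp add: c_def)
  have run: "R (3 * i + 2) = Transition (y i) (p (Suc i))" for i
  proof -
    have "(3 * i + 2) mod 3 \<noteq> 0" "(3 * i + 2) div 3 = i"
      by presburger+
    then have "c (3 * i + 2) = Transition (y i) (p (Suc i))"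
      unfolding c_def by simp
    then show ?thesis
      using adam[of "3 * i + 2"] by (simp only: token_position) simp
  qed
  have "states_along A (\<lambda>i. R (3 * i + 2)) i = p i" for i
    using assms(3) by (cases i) (simp_all only: states_along_Suc states_along_0 run, simp_all add: is_run_def)
  then have "\<forall>n. position (G1 A) (prefix_of R n) \<notin> eve (G1 A) \<longrightarrow>
      R n \<in> legal (G1 A) (position (G1 A) (prefix_of R n))"
    using assms(2,3) unfolding all_nat_mod3[of "\<lambda>n. _ n \<notin> _ \<longrightarrow> _ n"] token_position letters run
    by (auto simp: is_run_def transitions_def in_letters_iff)
  then have "legal_play (G1 A) R"
    by (intro legal_consistent_play[OF assms(1) R]) auto
  with R letters run show ?thesis
    by blast
qed

lemma winning_adam_copies:
  assumes A: "Inf_automaton A" and s: "winning_strategy (G1 A) s"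
  shows "winning_strategy (letter_game A) (s \<circ> adam_copies)"
proof -
  have aut: "automaton A" and val: "val A = Inf_val"
    using A by (auto simp: Inf_automaton_def)
  have strat: "eve_strategy (G1 A) s"
    using s by (simp add: winning_strategy_def)
  have "P \<in> eve_wins (letter_game A)"
    if legal: "legal_play (letter_game A) P" and cons: "consistent (letter_game A) (s \<circ> adam_copies) P" for P
  proof -
    define w where "w i = letter (P (2 * i))" for i
    define x where "x i = weight (P (2 * i + 1))" for i
    define q where "q = states_along A (\<lambda>i. P (2 * i + 1))"
    have letters: "P (2 * i) = Letter (w i)" for i
      using legal by (simp add: legal_play_letter_iff in_letters_iff w_def)
    have w: "range w \<subseteq> alphabet A"
      using legal by (auto simp: legal_play_letter_iff in_letters_iff w_def)
    have run: "is_run A w q x"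
      using legal unfolding legal_play_letter_iff q_def x_def w_def by (intro is_run_states_along) simp
    have moves: "P (2 * i + 1) = Transition (x i) (q (Suc i))" for i
      using legal unfolding legal_play_letter_iff q_def x_def by (simp add: in_transitions_iff)
    have P_move: "P (2 * i + 1) = s (adam_copies (prefix_of P (2 * i + 1)))" for i
      using cons unfolding consistent_letter_iff by simp
    \<comment> \<open>Each run is bounded separately, so the supremum need not be attained. The run
      enters only the analysis; the strategy does not depend on it.\<close>
    have "val A y \<le> val A x" if y: "is_run A w p y" for p y
    proof -
      let ?v = "val A y"
      \<comment> \<open>A continuation from Eve's state at time \<open>j\<close>: entries of
        \<open>p\<close> and \<open>y\<close> before \<open>j\<close> are arbitrary. The bound
        \<open>?v\<close> remains the value of the originally fixed run.\<close>
      let ?from = "\<lambda>j p y. p j = q j \<and>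
        (\<forall>i\<ge>j. (y i, p (Suc i)) \<in> delta A (p i) (w i) \<and> ?v \<le> real_of_rat (y i))"
      have "(\<forall>i<j. ?v \<le> real_of_rat (x i)) \<and> (\<exists>p y. ?from j p y)" for j
      proof (induction j)
        case 0
        have "?from 0 p y"
          using y run le_Inf_val_iff[OF aut w y, of ?v] val by (simp add: is_run_def)
        then show ?case
          by blast
      next
        case (Suc j)
        then obtain p' y' where cont: "?from j p' y'" and x: "\<And>i. i < j \<Longrightarrow> ?v \<le> real_of_rat (x i)"
          by blast
        \<comment> \<open>Adam follows Eve's run for \<open>j\<close> transitions and then the
          continuation. The two pieces meet in the state \<open>p' j = q j\<close>, so states switch
          after index \<open>j\<close> but weights already at \<open>j\<close>.\<close>
        define p'' where "p'' i = (if i \<le> j then q i else p' i)" for i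
        define y'' where "y'' i = (if i < j then x i else y' i)" for i
        have run'': "is_run A w p'' y''"
          unfolding is_run_def
        proof (intro conjI allI)
          show "p'' 0 = initial A"
            using run by (simp add: p''_def is_run_def)
          show "(y'' i, p'' (Suc i)) \<in> delta A (p'' i) (w i)" for i
            using cont run by (cases i j rule: linorder_cases) (auto simp: p''_def y''_def is_run_def)
        qed
        have y'': "?v \<le> Inf_val y''"
          unfolding le_Inf_val_iff[OF aut w run''] using cont x by (simp add: y''_def)
        obtain R where R: "legal_play (G1 A) R" "consistent (G1 A) s R"
          and R_letters: "\<And>i. R (3 * i) = Letter (w i)"
          and R_adam: "\<And>i. R (3 * i + 2) = Transition (y'' i) (p'' (Suc i))"
          using G1_response[OF strat w run''] by blast
        have R_eve: "R (3 * i + 1) = s (prefix_of R (3 * i + 1))" for i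
          using R(2) unfolding consistent_G1_iff by simp
        define r where "r = states_along A (\<lambda>i. R (3 * i + 1))"
        define z where "z i = weight (R (3 * i + 1))" for i
        have run_r: "is_run A w r z"
          unfolding r_def z_def
          using R(1) R_letters by (intro is_run_states_along) (simp add: legal_play_G1_iff)
        have "R \<in> eve_wins (G1 A)"
          using s R by (simp add: winning_strategy_def)
        then have "Inf_val y'' \<le> Inf_val z"
          unfolding G1_simps R_adam val z_def by simp
        with y'' have z: "?v \<le> real_of_rat (z i)" for i
          using le_Inf_val_iff[OF aut w run_r, of ?v] by auto
        \<comment> \<open>Equal histories force equal moves of Eve, which Adam then copies. The case
          \<open>i = j\<close> is included because Adam's transitions before Eve's move number
          \<open>j\<close> all have index below \<open>j\<close>, where the spliced run is still
          Eve's.\<close>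
        have same: "prefix_of R (3 * i + 1) = adam_copies (prefix_of P (2 * i + 1))"
          if "i \<le> j" for i
          using that
        proof (induction i)
          case 0
          show ?case
            using R_letters[of 0] letters[of 0] adam_copies_snoc[of "[]" "P 0"] by simp
        next
          case (Suc i)
          have "R (3 * i + 1) = P (2 * i + 1)"
            using Suc R_eve[of i] P_move[of i] by simp
          moreover have "R (3 * i + 2) = P (2 * i + 1)"
            unfolding R_adam moves using Suc.prems by (simp add: p''_def y''_def)
          moreover have "R (3 * Suc i) = P (2 * Suc i)"
            using R_letters letters by metis
          moreover have "prefix_of R (3 * Suc i + 1) =
              prefix_of R (3 * i + 1) @ [R (3 * i + 1), R (3 * i + 2), R (3 * Suc i)]"
          proof -
            have eqs: "3 * Suc i + 1 = 3 * i + 1 + 3" "3 * i + 1 + 1 = 3 * i + 2"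
              "3 * i + 1 + 2 = 3 * Suc i"
              by simp_all
            show ?thesis
              unfolding eqs(1) prefix_of_add3 unfolding eqs(2,3) by (rule refl)
          qed
          moreover have "prefix_of P (2 * Suc i + 1) =
              (prefix_of P (2 * i + 1) @ [P (2 * i + 1)]) @ [P (2 * Suc i)]"
          proof -
            have eqs: "2 * Suc i + 1 = 2 * i + 1 + 2" "2 * i + 1 + 1 = 2 * Suc i"
              by simp_all
            show ?thesis
              unfolding eqs(1) prefix_of_add2 unfolding eqs(2) by simp
          qed
          moreover have "prefix_of R (3 * i + 1) = adam_copies (prefix_of P (2 * i + 1))"
            using Suc by simp
          ultimately show ?case
            by (simp only: adam_copies_snoc length_append length_prefix_of) simp
        qed
        have eq: "R (3 * i + 1) = P (2 * i + 1)" if "i \<le> j" for i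
          using R_eve[of i] P_move[of i] same[OF that] by simp
        \<comment> \<open>Eve's own run in \<open>R\<close> becomes the next continuation: its
          transition number \<open>j\<close> is the one made in the letter game, and all its weights
          are at least \<open>?v\<close>.\<close>
        have "x j = z j" "r (Suc j) = q (Suc j)"
          using eq[of j] by (simp_all add: x_def z_def r_def q_def)
        with z x have "\<forall>i<Suc j. ?v \<le> real_of_rat (x i)" "?from (Suc j) r z"
          using run_r by (auto simp: less_Suc_eq is_run_def)
        then show ?case
          by blast
      qed
      then show ?thesis
        using le_Inf_val_iff[OF aut w run, of ?v] val by auto
    qed
    then have "aut_value A w \<le> val A x"
      unfolding aut_value_def using run by (intro cSup_least) auto
    then show ?thesis
      by (simp add: w_def[abs_def] x_def[abs_def])
  qed
  then show ?thesis
    using eve_strategy_adam_copies[OF strat] by (simp add: winning_strategy_def)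
qed

section \<open>From the letter game to the one-token game\<close>

definition forget_adam :: "'b list \<Rightarrow> 'b list" where
  "forget_adam h = nths h {i. i mod 3 \<noteq> 2}"

lemma forget_adam_Nil [simp]: "forget_adam [] = []"
  by (simp add: forget_adam_def)

lemma forget_adam_snoc [simp]:
  "forget_adam (h @ [b]) = forget_adam h @ (if length h mod 3 = 2 then [] else [b])"
  by (simp add: forget_adam_def nths_append nths_singleton)

text \<open>Adam's transition is invisible in the letter game, so the positions just before and just
  after it have the same image.\<close>

fun eve_token :: "('a, 'q) token_pos \<Rightarrow> ('a, 'q) letter_pos" where
  "eve_token (TLetter q p) = LAdam q"
| "eve_token (TEve q p a) = LEve q a"
| "eve_token (TTrans q p a) = LAdam q"

lemma token_position_mod3:
  "\<exists>q p a. position (G1 A) h =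
     (if length h mod 3 = 0 then TLetter q p else if length h mod 3 = 1 then TEve q p a else TTrans q p a)"
  by (induction h rule: rev_induct) (auto simp: mod_Suc split: if_splits)

lemma position_forget_adam:
  "position (letter_game A) (forget_adam h) = eve_token (position (G1 A) h)"
proof (induction h rule: rev_induct)
  case (snoc b h)
  obtain q p a where "position (G1 A) h =
      (if length h mod 3 = 0 then TLetter q p else if length h mod 3 = 1 then TEve q p a else TTrans q p a)"
    using token_position_mod3 by metis
  moreover have "length h mod 3 = 0 \<or> length h mod 3 = 1 \<or> length h mod 3 = 2"
    by presburger
  ultimately show ?case
    using snoc by auto
qed simp

lemma legal_history_forget_adam:
  "legal_history (G1 A) h \<Longrightarrow> legal_history (letter_game A) (forget_adam h)"
proof (induction h rule: rev_induct)
  case (snoc b h)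
  obtain q p a where "position (G1 A) h =
      (if length h mod 3 = 0 then TLetter q p else if length h mod 3 = 1 then TEve q p a else TTrans q p a)"
    using token_position_mod3 by metis
  moreover have "length h mod 3 = 0 \<or> length h mod 3 = 1 \<or> length h mod 3 = 2"
    by presburger
  ultimately show ?case
    using snoc by (auto simp: position_forget_adam)
qed simp

text \<open>Adam's token traces a run on the word played, so its value is at most the value of the
  word, which Eve's run reaches by winning the letter game.\<close>

lemma winning_forget_adam:
  assumes A: "Inf_automaton A" and s: "winning_strategy (letter_game A) s"
  shows "winning_strategy (G1 A) (s \<circ> forget_adam)"
proof -
  have "eve_strategy (G1 A) (s \<circ> forget_adam)"
    unfolding eve_strategy_def
  proof (intro allI impI)
    fix h
    assume h: "legal_history (G1 A) h" "position (G1 A) h \<in> eve (G1 A)"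
    then obtain q p a where "position (G1 A) h = TEve q p a"
      by auto
    then show "(s \<circ> forget_adam) h \<in> legal (G1 A) (position (G1 A) h)"
      using s legal_history_forget_adam[OF h(1)] position_forget_adam[of A h]
      unfolding eve_strategy_def winning_strategy_def by fastforce
  qed
  moreover have "R \<in> eve_wins (G1 A)"
    if legal: "legal_play (G1 A) R" and cons: "consistent (G1 A) (s \<circ> forget_adam) R" for R
  proof -
    \<comment> \<open>Renumbering that skips Adam's transitions: \<open>2 * i\<close> and
      \<open>2 * i + 1\<close> go to \<open>3 * i\<close> and \<open>3 * i + 1\<close>.\<close>
    define P where "P n = R (3 * (n div 2) + n mod 2)" for n
    have P: "P (2 * i) = R (3 * i)" "P (2 * i + 1) = R (3 * i + 1)" for i
      by (simp_all add: P_def)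
    have even: "prefix_of P (2 * i) = forget_adam (prefix_of R (3 * i))" for i
    proof (induction i)
      case (Suc i)
      have eqs: "2 * Suc i = Suc (Suc (2 * i))" "3 * Suc i = Suc (Suc (Suc (3 * i)))"
        by simp_all
      show ?case
        unfolding eqs prefix_of_Suc forget_adam_snoc Suc[symmetric] using P[of i] by (simp add: mod_Suc)
    qed simp
    have odd: "prefix_of P (2 * i + 1) = forget_adam (prefix_of R (3 * i + 1))" for i
      using even[of i] P[of i] by simp
    have "legal_play (letter_game A) P"
      using legal unfolding legal_play_letter_iff legal_play_G1_iff P by blast
    moreover have "consistent (letter_game A) s P"
      using cons unfolding consistent_letter_iff consistent_G1_iff P odd by simp
    ultimately have "P \<in> eve_wins (letter_game A)"
      using s by (simp add: winning_strategy_def)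
    then have "aut_value A (\<lambda>i. letter (R (3 * i))) \<le> val A (\<lambda>i. weight (R (3 * i + 1)))"
      unfolding letter_game_simps P .
    moreover have "val A (\<lambda>i. weight (R (3 * i + 2))) \<le> aut_value A (\<lambda>i. letter (R (3 * i)))"
    proof (rule run_le_aut_value[OF A])
      show "range (\<lambda>i. letter (R (3 * i))) \<subseteq> alphabet A"
        using legal by (auto simp: legal_play_G1_iff in_letters_iff)
      show "is_run A (\<lambda>i. letter (R (3 * i))) (states_along A (\<lambda>i. R (3 * i + 2)))
          (\<lambda>i. weight (R (3 * i + 2)))"
        using legal by (intro is_run_states_along) (simp add: legal_play_G1_iff)
    qed
    ultimately show ?thesis
      by simp
  qed
  ultimately show ?thesis
    by (simp add: winning_strategy_def)
qed

theorem theorem4p5: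
  fixes A :: "('a, 'q) automaton"
  assumes "Inf_automaton A \<or> Safety_automaton A"
  shows "(Eve_wins (G1 A) \<longleftrightarrow> history_deterministic A) \<and>
    (\<forall>s. winning_strategy (G1 A) s \<longrightarrow>
       (\<exists>s'. winning_strategy (letter_game A) s' \<and>
          (\<forall>M :: 'm set. implemented_with (G1 A) s M \<longrightarrow>
             (\<exists>M' :: 'm set. M' \<approx> M \<and> implemented_with (letter_game A) s' M'))))"
proof -
  have A: "Inf_automaton A"
    using assms by (auto simp: Safety_automaton_def)
  \<comment> \<open>The strategy \<open>s \<circ> adam_copies\<close> is chosen before
    \<open>M\<close>, and \<open>M\<close> itself serves as \<open>M'\<close>.\<close>
  show ?thesis
    unfolding Eve_wins_def history_deterministic_def
    using winning_adam_copies[OF A] winning_forget_adam[OF A]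
      implemented_with_adam_copies eqpoll_refl by blast
qed

end
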